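(* Let $(Y,\nu)$ be a probability space, $S:Y\to Y$ an ergodic $\nu$-preserving transformation, $G$ a countable discrete group with identity $e$, and $f:Y\to G$ a measurable function. Let $X=Y\times G$, let $\mu$ be the product of $\nu$ and the counting measure on $G$, let $T(y,g)=(S(y),g\cdot f(y))$, and assume that $(X,\mu,T)$ is conservative and ergodic. Let $\{N_k\}_{k\ge 1}$ be an increasing sequence of positive integers, fix $\epsilon_1\in(0,1]$, and let $\{\rho_k\}_{k\ge1}$ be positive numbers such that $$\nu\{y\in Y: r_k(y)\le \rho_k\}\ge \epsilon_1\quad\text{for every }k,$$ where $r_k(y)$ is the number of distinct elements of $G$ among the products $\prod_{i=0}^{n-1}f(S^iy)$, $n=1,2,\ldots,N_k$. Suppose that $\rho_k\in o(N_k)$, and that there is a $\delta>0$ such that $$\frac{N_k}{\rho_k}\ge \delta\sum_{i=1}^{k-1}\frac{N_i}{\rho_i}$$ for all sufficiently large $k$. Then $(X,\mu,T)$ is $\omega$-recurrent for every nonincreasing, regularly varying $\omega:\mathbb{R}^+\to\mathbb{R}^+$ such that $$\sum_{k=1}^\infty \omega(N_k)\frac{N_k}{\rho_k}=\infty.$$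
   Context: Products are ordered: $\prod_{i=0}^{n-1}f(S^iy)=f(y)\cdot f(Sy)\cdots f(S^{n-1}y)$. "Regularly varying" means: for every $k\in\mathbb{R}^+$, $\omega(kx)\asymp\omega(x)$, i.e. the ratio is bounded above and below by positive constants (which may depend on $k$). For a set $A\subset X$ with $0<\mu(A)<\infty$ and $x\in X$, put $\zeta(x)=\sum_{i=0}^{\infty}\chi_A(T^ix)\,\omega(i)$. When $T$ is conservative and ergodic, $\zeta$ is either finite $\mu$-almost everywhere or infinite $\mu$-almost everywhere, and which alternative holds does not depend on the choice of $A$ (of positive finite measure). The system is called $\omega$-recurrent if $\zeta(x)=\infty$ for $\mu$-almost every $x$. If $\omega$ is given by a formula valid only for large $n$, the sum is started at an index from which the formula is defined and nonincreasing; this does not affect $\omega$-recurrence. *)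

theory Defs
  imports
    "HOL-Probability.Probability"
    "HOL-Algebra.Group"
    "HOL-Library.Landau_Symbols"
begin

definition measure_preserving :: "'a measure \<Rightarrow> ('a \<Rightarrow> 'a) \<Rightarrow> bool" where
  "measure_preserving M T \<longleftrightarrow> T \<in> M \<rightarrow>\<^sub>M M \<and> distr M M T = M"

text \<open>The next two notions also apply to infinite measures and to non-invertible maps.\<close>

definition ergodic :: "'a measure \<Rightarrow> ('a \<Rightarrow> 'a) \<Rightarrow> bool" where
  "ergodic M T \<longleftrightarrow>
     (\<forall>A\<in>sets M. T -` A \<inter> space M = A \<longrightarrow> A \<in> null_sets M \<or> space M - A \<in> null_sets M)"

text \<open>A wandering set is a measurable set whose preimages under the powers
  \<open>T\<^sup>0, T\<^sup>1, T\<^sup>2, \<dots>\<close> are pairwise disjoint; a system is conservative when all of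
  these are null.\<close>

definition conservative :: "'a measure \<Rightarrow> ('a \<Rightarrow> 'a) \<Rightarrow> bool" where
  "conservative M T \<longleftrightarrow>
     (\<forall>W\<in>sets M. disjoint_family (\<lambda>n::nat. (T ^^ n) -` W \<inter> space M) \<longrightarrow> W \<in> null_sets M)"

primrec cocycle_prod ::
  "('g, 'b) monoid_scheme \<Rightarrow> ('y \<Rightarrow> 'y) \<Rightarrow> ('y \<Rightarrow> 'g) \<Rightarrow> nat \<Rightarrow> 'y \<Rightarrow> 'g" where
  "cocycle_prod G S f 0 y = \<one>\<^bsub>G\<^esub>"
| "cocycle_prod G S f (Suc n) y = cocycle_prod G S f n y \<otimes>\<^bsub>G\<^esub> f ((S ^^ n) y)"

definition skew_product ::
  "('g, 'b) monoid_scheme \<Rightarrow> ('y \<Rightarrow> 'y) \<Rightarrow> ('y \<Rightarrow> 'g) \<Rightarrow> 'y \<times> 'g \<Rightarrow> 'y \<times> 'g" where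
  "skew_product G S f = (\<lambda>(y, g). (S y, g \<otimes>\<^bsub>G\<^esub> f y))"

definition range_count ::
  "('g, 'b) monoid_scheme \<Rightarrow> ('y \<Rightarrow> 'y) \<Rightarrow> ('y \<Rightarrow> 'g) \<Rightarrow> nat \<Rightarrow> 'y \<Rightarrow> nat" where
  "range_count G S f N y = card ((\<lambda>n. cocycle_prod G S f n y) ` {1..N})"

text \<open>A function \<open>\<omega> : \<real>\<^sup>+ \<rightarrow> \<real>\<^sup>+\<close> is represented by a total function on the reals of which
  only the restriction to \<open>{0<..}\<close> is constrained.\<close>

definition regularly_varying :: "(real \<Rightarrow> real) \<Rightarrow> bool" where
  "regularly_varying \<omega> \<longleftrightarrow>
     (\<forall>k>0. \<exists>c>0. \<exists>C>0. \<forall>x>0. c * \<omega> x \<le> \<omega> (k * x) \<and> \<omega> (k * x) \<le> C * \<omega> x)"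

text \<open>The value \<open>\<omega> 0\<close> is an arbitrary real number, so the term for \<open>i = 0\<close> is finite
  (\<open>ennreal\<close> sends negative reals to \<open>0\<close>) and does not influence whether the sum is infinite.\<close>

definition weighted_visits ::
  "('a \<Rightarrow> 'a) \<Rightarrow> (real \<Rightarrow> real) \<Rightarrow> 'a set \<Rightarrow> 'a \<Rightarrow> ennreal" where
  "weighted_visits T \<omega> A x = (\<Sum>i. indicator A ((T ^^ i) x) * ennreal (\<omega> (real i)))"

text \<open>For conservative ergodic systems and nonincreasing, regularly varying \<open>\<omega>\<close>, the condition
  holds for one \<open>A\<close> of positive finite measure if and only if it holds for all of them; we require it for all.\<close>

definition omega_recurrent ::
  "'a measure \<Rightarrow> ('a \<Rightarrow> 'a) \<Rightarrow> (real \<Rightarrow> real) \<Rightarrow> bool" where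
  "omega_recurrent M T \<omega> \<longleftrightarrow>
     (\<forall>A\<in>sets M. 0 < emeasure M A \<and> emeasure M A < \<infinity> \<longrightarrow>
        (AE x in M. weighted_visits T \<omega> A x = \<infinity>))"

end

theory Submission
  imports Defs
begin

text \<open>
  Put \<open>a\<^sub>k = N\<^sub>k / \<rho>\<^sub>k\<close>. A cocycle that takes at most \<open>\<rho>\<^sub>k\<close> values during \<open>N\<^sub>k\<close> steps takes
  a typical one of them about \<open>a\<^sub>k\<close> times. Two occurrences of the same value, at times \<open>n < m\<close>,
  mean that the orbit started at \<open>S\<^sup>n y\<close> returns to the identity after \<open>m - n\<close> steps; since \<open>S\<close>
  preserves \<open>\<nu>\<close>, the point \<open>S\<^sup>n y\<close> is as typical as \<open>y\<close>. Averaging over \<open>n\<close> shows that, for large \<open>k\<close> and with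
  probability bounded below independently of \<open>k\<close>, there are at least \<open>a\<^sub>k / 4\<close> returns within time
  \<open>N\<^sub>k\<close>. The same count works for returns at which the base point lies in a
  prescribed set \<open>B\<close> with \<open>\<nu> B \<ge> 1 - \<epsilon>\<^sub>1 / 4\<close> (\<open>measure_frequent_returns\<close>).

  To pass from these separate scales to the weighted sum, bound \<open>\<omega>\<close> below by the step
  function that takes its values at the \<open>N\<^sub>k\<close>, and sum by parts. This bounds the sum below by
  \<open>\<Sum>\<^sub>k w\<^sub>k a\<^sub>k / 4\<close> over the good scales \<open>k\<close>, where \<open>w\<^sub>k\<close> are the jumps. The growth hypothesis says
  that \<open>a\<^sub>k\<close> is comparable to its partial sums, so undoing the Abel summation gives
  \<open>\<Sum>\<^sub>k w\<^sub>k a\<^sub>k \<ge> c \<Sum>\<^sub>k \<omega>(N\<^sub>k) a\<^sub>k\<close>, which is unbounded. As every scale is good with probability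
  bounded below, the weighted sum is infinite with positive probability
  (\<open>not_AE_finite_of_frequent_times\<close>).

  An arbitrary target set \<open>A\<close> of positive measure is handled through the choice of \<open>B\<close>. By
  conservativity and ergodicity almost every orbit meets \<open>A\<close>, hence the set \<open>B\<close> of those \<open>y\<close> for which
  the orbit of \<open>(y, e)\<close> meets \<open>A\<close> within \<open>l\<close> steps has measure close to \<open>1\<close> when \<open>l\<close> is large.
  Each visit to \<open>B \<times> {e}\<close> is followed by a visit to \<open>A\<close> within \<open>l\<close> steps, and regular variation makes
  such a delay harmless. Finally, the set of points with infinite weighted sum is
  invariant, so ergodicity upgrades positive measure to full measure.
\<close>

section \<open>Visits in conservative ergodic systems\<close>

text \<open>
  Every preimage of a wandering set is again wandering, and conservativity applies to it.
\<close>

lemma wandering_vimage_null: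
  assumes T: "T \<in> M \<rightarrow>\<^sub>M M" and cons: "conservative M T" and W: "W \<in> sets M"
    and disj: "disjoint_family (\<lambda>n::nat. (T ^^ n) -` W \<inter> space M)"
  shows "(T ^^ k) -` W \<inter> space M \<in> null_sets M"
proof -
  have Tn: "(T ^^ n) \<in> M \<rightarrow>\<^sub>M M" for n
    using T by (rule measurable_compose_n)
  have eq: "(T ^^ n) -` ((T ^^ k) -` W \<inter> space M) \<inter> space M = (T ^^ (k + n)) -` W \<inter> space M" for n
    using measurable_space[OF Tn] by (auto simp: funpow_add)
  have "disjoint_family (\<lambda>n. (T ^^ n) -` ((T ^^ k) -` W \<inter> space M) \<inter> space M)"
    unfolding eq disjoint_family_on_def
  proof (intro ballI impI)
    fix m n :: nat assume "m \<noteq> n"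
    then have "k + m \<noteq> k + n" by simp
    then show "((T ^^ (k + m)) -` W \<inter> space M) \<inter> ((T ^^ (k + n)) -` W \<inter> space M) = {}"
      using disj unfolding disjoint_family_on_def by (meson UNIV_I)
  qed
  then show ?thesis
    using cons measurable_sets[OF Tn W] unfolding conservative_def by blast
qed

text \<open>
  Let \<open>U\<^sub>k\<close> be the set of points that visit \<open>A\<close> at some time \<open>\<ge> k\<close>. Then \<open>U\<^sub>k\<close> is the preimage of
  \<open>U\<^sub>0\<close> under \<open>T\<^sup>k\<close>, and \<open>U\<^sub>0 - U\<^sub>1\<close>, on which the last visit happens at time \<open>0\<close>, is wandering.
  Up to null sets, \<open>U\<^sub>0\<close> therefore equals the strictly invariant set \<open>\<Inter>\<^sub>k U\<^sub>k\<close>. Since \<open>A \<subseteq> U\<^sub>0\<close>, that set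
  is not null, so its complement is.
\<close>

lemma AE_visits_of_conservative_ergodic:
  assumes T: "T \<in> M \<rightarrow>\<^sub>M M" and cons: "conservative M T" and erg: "ergodic M T"
    and A: "A \<in> sets M" "A \<notin> null_sets M"
  shows "AE x in M. \<exists>n. (T ^^ n) x \<in> A"
proof -
  have Tn: "(T ^^ n) \<in> M \<rightarrow>\<^sub>M M" for n
    using T by (rule measurable_compose_n)
  note Tsp = measurable_space[OF Tn]
  define U where "U k = {x \<in> space M. \<exists>n\<ge>k. (T ^^ n) x \<in> A}" for k :: nat
  have U_eq: "U k = (\<Union>n\<in>{k..}. (T ^^ n) -` A \<inter> space M)" for k
    unfolding U_def by auto
  have U_meas [measurable]: "U k \<in> sets M" for k
    unfolding U_eq by (rule sets.countable_UN'') (use measurable_sets[OF Tn A(1)] in auto)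
  have shift: "(T ^^ k) -` U m \<inter> space M = U (m + k)" for k m
  proof (intro Set.set_eqI iffI)
    fix x assume "x \<in> U (m + k)"
    then obtain n where n: "x \<in> space M" "n \<ge> m + k" "(T ^^ n) x \<in> A"
      unfolding U_def by auto
    then have "(T ^^ (n - k)) ((T ^^ k) x) \<in> A"
      by (metis add_leD2 comp_apply funpow_add le_add_diff_inverse2)
    then show "x \<in> (T ^^ k) -` U m \<inter> space M"
      using n Tsp unfolding U_def by (auto intro!: exI[of _ "n - k"])
  next
    fix x assume "x \<in> (T ^^ k) -` U m \<inter> space M"
    then obtain n where "x \<in> space M" "n \<ge> m" "(T ^^ n) ((T ^^ k) x) \<in> A"
      unfolding U_def by auto
    then show "x \<in> U (m + k)"
      unfolding U_def by (auto simp: funpow_add intro!: exI[of _ "n + k"])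
  qed
  have dec: "U n \<subseteq> U m" if "m \<le> n" for m n
  proof
    fix x assume "x \<in> U n"
    then obtain k where "x \<in> space M" "k \<ge> n" "(T ^^ k) x \<in> A" unfolding U_def by auto
    then show "x \<in> U m" using that unfolding U_def by (auto intro!: exI[of _ k])
  qed
  define W where "W = U 0 - U 1"
  have W_n: "(T ^^ n) -` W \<inter> space M = U n - U (Suc n)" for n
    using shift[of n 0] shift[of n 1] unfolding W_def by auto
  have "disjoint_family (\<lambda>n. (T ^^ n) -` W \<inter> space M)"
    unfolding W_n disjoint_family_on_def
  proof (intro ballI impI)
    fix m n :: nat assume "m \<noteq> n"
    then show "(U m - U (Suc m)) \<inter> (U n - U (Suc n)) = {}"
      using dec[of "Suc m" n] dec[of "Suc n" m] by (cases "m < n") auto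
  qed
  then have W_null: "U n - U (Suc n) \<in> null_sets M" for n
    using wandering_vimage_null[OF T cons, of W n] W_n unfolding W_def by simp
  define V where "V = (\<Inter>n. U n)"
  have V_meas: "V \<in> sets M" unfolding V_def by measurable
  have "T -` V \<inter> space M = (\<Inter>n. T -` U n \<inter> space M)"
    unfolding V_def by auto
  also have "\<dots> = (\<Inter>n. U (Suc n))"
    using shift[of 1] by simp
  also have "\<dots> = V"
  proof -
    have "U (Suc n) \<subseteq> U n" for n by (rule dec) simp
    then show ?thesis unfolding V_def by fast
  qed
  finally have "T -` V \<inter> space M = V" .
  then have dich: "V \<in> null_sets M \<or> space M - V \<in> null_sets M"
    using erg V_meas unfolding ergodic_def by blast
  have "U 0 \<subseteq> V \<union> (\<Union>n. U n - U (Suc n))"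
  proof
    fix x assume x: "x \<in> U 0"
    show "x \<in> V \<union> (\<Union>n. U n - U (Suc n))"
    proof (rule ccontr)
      assume not: "x \<notin> V \<union> (\<Union>n. U n - U (Suc n))"
      have "x \<in> U n" for n
        using x not by (induction n) auto
      then show False using not unfolding V_def by auto
    qed
  qed
  have "V \<notin> null_sets M"
  proof
    assume "V \<in> null_sets M"
    then have "V \<union> (\<Union>n. U n - U (Suc n)) \<in> null_sets M"
      using W_null by (intro null_sets.Un null_sets_UN) auto
    then have "U 0 \<in> null_sets M"
      using \<open>U 0 \<subseteq> _\<close> U_meas null_sets_subset by blast
    moreover have "A \<subseteq> U 0"
      using sets.sets_into_space[OF A(1)] unfolding U_def by (auto intro!: exI[of _ 0])
    ultimately show False using A null_sets_subset by blast
  qed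
  then have "space M - V \<in> null_sets M" using dich by blast
  then show ?thesis
    by (rule AE_I') (auto simp: V_def U_def)
qed

lemma measure_preserving_funpow:
  assumes S: "measure_preserving M S" and E: "E \<in> sets M"
  shows "measure M ((S ^^ n) -` E \<inter> space M) = measure M E"
  using E
proof (induction n arbitrary: E)
  case (Suc n)
  have Sm: "S \<in> M \<rightarrow>\<^sub>M M" "distr M M S = M" using S unfolding measure_preserving_def by auto
  have pre: "S -` E \<inter> space M \<in> sets M" using Sm(1) Suc.prems by (rule measurable_sets)
  have "(S ^^ Suc n) -` E \<inter> space M = (S ^^ n) -` (S -` E \<inter> space M) \<inter> space M"
    using measurable_space[OF measurable_compose_n[OF Sm(1)]] by auto
  then have "measure M ((S ^^ Suc n) -` E \<inter> space M) = measure M (S -` E \<inter> space M)"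
    by (simp only: Suc.IH[OF pre])
  also have "\<dots> = measure M E"
    using measure_distr[OF Sm(1) Suc.prems] Sm(2) by simp
  finally show ?case .
qed (simp add: sets.Int_space_eq2)

section \<open>Infinite weighted sums over sets of times\<close>

text \<open>
  Since \<open>i + m \<le> (n + 1) i\<close> for \<open>i \<ge> 1\<close>, monotonicity reduces a bounded shift to a dilation.
\<close>

lemma regularly_varying_shift_bound:
  fixes \<omega> :: "real \<Rightarrow> real"
  assumes anti: "antimono_on {0<..} \<omega>" and rv: "regularly_varying \<omega>"
  obtains C where "C > 0" "\<And>i m. 1 \<le> i \<Longrightarrow> m \<le> n \<Longrightarrow> \<omega> (real i) \<le> C * \<omega> (real (i + m))"
proof -
  obtain c where c: "c > 0" "\<And>x. x > 0 \<Longrightarrow> c * \<omega> x \<le> \<omega> (real (Suc n) * x)"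
    using rv unfolding regularly_varying_def by (metis of_nat_0_less_iff zero_less_Suc)
  show ?thesis
  proof
    show "1 / c > 0" using c by simp
    fix i m :: nat assume im: "1 \<le> i" "m \<le> n"
    have "i + m \<le> Suc n * i" using im by (simp add: order.trans[of m "n * 1" "n * i"])
    then have "real (i + m) \<le> real (Suc n) * real i"
      by (metis of_nat_le_iff of_nat_mult)
    moreover have "real (i + m) > 0" using im by simp
    ultimately have "\<omega> (real (Suc n) * real i) \<le> \<omega> (real (i + m))"
      using anti by (auto simp: monotone_on_def)
    moreover have "c * \<omega> (real i) \<le> \<omega> (real (Suc n) * real i)" using c(2)[of "real i"] im by simp
    ultimately have "c * \<omega> (real i) \<le> \<omega> (real (i + m))" by linarith
    then show "\<omega> (real i) \<le> 1 / c * \<omega> (real (i + m))" using c by (simp add: field_simps)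
  qed
qed

text \<open>
  Each time in \<open>J'\<close> absorbs at most \<open>n + 1\<close> times of \<open>J\<close>, each of comparable weight. This serves
  twice: to replace one target set by another, and for invariance under the dynamics.
\<close>

lemma weighted_times_delay:
  fixes \<omega> :: "real \<Rightarrow> real" and J J' :: "nat set"
  assumes anti: "antimono_on {0<..} \<omega>" and rv: "regularly_varying \<omega>"
    and delay: "\<And>i. i \<in> J \<Longrightarrow> \<exists>m\<le>n. i + m \<in> J'"
    and inf: "(\<Sum>i. indicator J i * ennreal (\<omega> (real i))) = \<infinity>"
  shows "(\<Sum>i. indicator J' i * ennreal (\<omega> (real i))) = \<infinity>"
proof -
  let ?s = "\<lambda>J i. indicator J i * ennreal (\<omega> (real i))"
  obtain C where C: "C > 0" "\<And>i m. 1 \<le> i \<Longrightarrow> m \<le> n \<Longrightarrow> \<omega> (real i) \<le> C * \<omega> (real (i + m))"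
    using regularly_varying_shift_bound[OF anti rv] by metis
  have term_le: "?s J (Suc i) \<le> (\<Sum>m\<le>n. ennreal C * ?s J' (Suc i + m))" for i
  proof (cases "Suc i \<in> J")
    case True
    then obtain m where m: "m \<le> n" "Suc i + m \<in> J'" using delay by blast
    have "ennreal (\<omega> (real (Suc i))) \<le> ennreal (C * \<omega> (real (Suc i + m)))"
      using C(2)[of "Suc i" m] m by (intro ennreal_leI) auto
    also have "\<dots> = ennreal C * ?s J' (Suc i + m)"
      using m C(1) by (simp add: ennreal_mult')
    also have "\<dots> \<le> (\<Sum>m\<le>n. ennreal C * ?s J' (Suc i + m))"
      using m by (intro member_le_sum) auto
    finally show ?thesis using True by simp
  qed simp
  have tail_le: "(\<Sum>i. ?s J' (Suc i + m)) \<le> (\<Sum>i. ?s J' i)" for m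
    using suminf_offset[of "?s J'" "Suc m"] by (simp add: add.commute add_increasing)
  have "(\<Sum>i. ?s J i) = ?s J 0 + (\<Sum>i. ?s J (Suc i))"
    by (subst suminf_offset[of "?s J" 1]) (simp_all add: add.commute)
  also have "\<dots> \<le> ?s J 0 + (\<Sum>i. \<Sum>m\<le>n. ennreal C * ?s J' (Suc i + m))"
    using term_le by (intro add_left_mono suminf_le) auto
  also have "(\<Sum>i. \<Sum>m\<le>n. ennreal C * ?s J' (Suc i + m))
      = (\<Sum>m\<le>n. ennreal C * (\<Sum>i. ?s J' (Suc i + m)))"
    by (subst suminf_sum) auto
  also have "\<dots> \<le> (\<Sum>m\<le>n. ennreal C * (\<Sum>i. ?s J' i))"
    using tail_le by (intro sum_mono mult_left_mono) auto
  finally have "\<infinity> \<le> ?s J 0 + (\<Sum>m\<le>n. ennreal C * (\<Sum>i. ?s J' i))"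
    using inf by simp
  moreover have "?s J 0 < \<infinity>" by (simp add: indicator_def)
  ultimately show ?thesis
    by (cases "(\<Sum>i. ?s J' i)") (auto simp: ennreal_mult_eq_top_iff top_unique)
qed

text \<open>
  The weights increase when times are moved one step earlier. The terms for \<open>0\<close> and \<open>1\<close> are split off
  because \<open>\<omega> 0\<close> is not related to the other values.
\<close>

lemma weighted_times_advance:
  fixes \<omega> :: "real \<Rightarrow> real" and J :: "nat set"
  assumes anti: "antimono_on {0<..} \<omega>"
    and inf: "(\<Sum>i. indicator J i * ennreal (\<omega> (real i))) = \<infinity>"
  shows "(\<Sum>i. indicator {i. Suc i \<in> J} i * ennreal (\<omega> (real i))) = \<infinity>"
proof -
  let ?s = "\<lambda>J i. indicator J i * ennreal (\<omega> (real i))"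
  let ?J = "{i. Suc i \<in> J}"
  have "(\<Sum>i. ?s J i) = (\<Sum>i<2. ?s J i) + (\<Sum>i. ?s J (i + 2))"
    by (subst suminf_offset[of "?s J" 2]) (simp_all add: add.commute)
  also have "(\<Sum>i. ?s J (i + 2)) \<le> (\<Sum>i. ?s ?J (i + 1))"
  proof (intro suminf_le)
    fix i
    have "\<omega> (real (i + 2)) \<le> \<omega> (real (i + 1))"
      using anti by (auto simp: monotone_on_def)
    then have "ennreal (\<omega> (real (i + 2))) \<le> ennreal (\<omega> (real (i + 1)))" by (rule ennreal_leI)
    then show "?s J (i + 2) \<le> ?s ?J (i + 1)"
      by (auto simp: indicator_def)
  qed auto
  also have "(\<Sum>i. ?s ?J (i + 1)) \<le> (\<Sum>i. ?s ?J i)"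
    using suminf_offset[of "?s ?J" 1] by (simp add: add_increasing)
  finally have "\<infinity> \<le> (\<Sum>i<2. ?s J i) + (\<Sum>i. ?s ?J i)"
    using inf by (simp add: add_left_mono)
  moreover have "(\<Sum>i<2. ?s J i) < \<infinity>" by (auto simp: numeral_2_eq_2 indicator_def)
  ultimately show ?thesis by (auto simp: top_unique)
qed

lemma weighted_visits_eq:
  "weighted_visits T \<omega> A x = (\<Sum>i. indicator {i. (T ^^ i) x \<in> A} i * ennreal (\<omega> (real i)))"
  unfolding weighted_visits_def by (intro suminf_cong) (simp add: indicator_def)

lemma weighted_visits_measurable:
  assumes T: "T \<in> M \<rightarrow>\<^sub>M M" and A: "A \<in> sets M"
  shows "weighted_visits T \<omega> A \<in> borel_measurable M"
proof -
  have [measurable]: "(T ^^ i) \<in> M \<rightarrow>\<^sub>M M" for i using T by (rule measurable_compose_n)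
  note A[measurable]
  show ?thesis unfolding weighted_visits_def[abs_def] by measurable
qed

text \<open>
  Passing from \<open>x\<close> to \<open>T x\<close> shifts the visiting times by one, so the set of points with infinite
  weighted sum is strictly invariant.
\<close>

lemma AE_weighted_visits_infinite:
  fixes \<omega> :: "real \<Rightarrow> real"
  assumes T: "T \<in> M \<rightarrow>\<^sub>M M" and erg: "ergodic M T" and A: "A \<in> sets M"
    and anti: "antimono_on {0<..} \<omega>" and rv: "regularly_varying \<omega>"
    and not_fin: "\<not> (AE x in M. weighted_visits T \<omega> A x \<noteq> \<infinity>)"
  shows "AE x in M. weighted_visits T \<omega> A x = \<infinity>"
proof -
  let ?I = "{x \<in> space M. weighted_visits T \<omega> A x = \<infinity>}"
  note [measurable] = weighted_visits_measurable[OF T A]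
  have I: "?I \<in> sets M" by measurable
  have "weighted_visits T \<omega> A (T x) = \<infinity> \<longleftrightarrow> weighted_visits T \<omega> A x = \<infinity>" for x
  proof
    have *: "{i. (T ^^ i) (T x) \<in> A} = {i. Suc i \<in> {i. (T ^^ i) x \<in> A}}"
      by (simp add: funpow_swap1)
    { assume "weighted_visits T \<omega> A x = \<infinity>"
      then show "weighted_visits T \<omega> A (T x) = \<infinity>"
        unfolding weighted_visits_eq * by (rule weighted_times_advance[OF anti]) }
    { assume "weighted_visits T \<omega> A (T x) = \<infinity>"
      then show "weighted_visits T \<omega> A x = \<infinity>"
        unfolding weighted_visits_eq *
        by (rule weighted_times_delay[OF anti rv, where n = 1, rotated]) (auto intro!: exI[of _ 1]) }
  qed
  then have "T -` ?I \<inter> space M = ?I"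
    using measurable_space[OF T] by auto
  then have "?I \<in> null_sets M \<or> space M - ?I \<in> null_sets M"
    using erg I unfolding ergodic_def by blast
  moreover have "?I \<notin> null_sets M"
  proof
    assume "?I \<in> null_sets M"
    then have "AE x in M. weighted_visits T \<omega> A x \<noteq> \<infinity>"
      by (rule AE_I') auto
    then show False using not_fin by simp
  qed
  ultimately have "space M - ?I \<in> null_sets M" by blast
  then show ?thesis by (rule AE_I') auto
qed

section \<open>Sums of weighted events\<close>

text \<open>
  If \<open>u\<close> were almost everywhere finite, it would be bounded by some \<open>L\<close> outside a set of measure
  less than \<open>\<eta> / 2\<close>. Every event keeps mass at least \<open>\<eta> / 2\<close> where \<open>u \<le> L\<close>, and integrating over this set
  gives \<open>(\<eta> / 2) \<Sum>\<^sub>j v\<^sub>K\<^sub>j \<le> L\<close> for all \<open>K\<close>.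
\<close>

lemma not_AE_finite_of_weighted_events:
  fixes u :: "'a \<Rightarrow> ennreal" and v :: "nat \<Rightarrow> nat \<Rightarrow> real"
  assumes M: "prob_space M" and E: "\<And>j. E j \<in> sets M"
    and \<eta>: "\<eta> > 0" "\<And>j. \<eta> \<le> measure M (E j)"
    and v: "\<And>K j. v K j \<ge> 0" and unb: "\<And>L. \<exists>K. L < (\<Sum>j\<le>K. v K j)"
    and u: "u \<in> borel_measurable M"
    and le: "\<And>K y. y \<in> space M \<Longrightarrow> ennreal (\<Sum>j\<le>K. v K j * indicator (E j) y) \<le> u y"
  shows "\<not> (AE y in M. u y \<noteq> \<infinity>)"
proof
  interpret prob_space M by fact
  note [measurable] = u E
  assume fin: "AE y in M. u y \<noteq> \<infinity>"
  define U where "U L = {y \<in> space M. u y \<le> of_nat L}" for L :: nat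
  have U_meas [measurable]: "U L \<in> sets M" for L unfolding U_def by measurable
  have "incseq U"
  proof (intro incseq_SucI subsetI)
    fix L y assume "y \<in> U L"
    then show "y \<in> U (Suc L)"
      unfolding U_def using order.trans[of "u y" "of_nat L" "of_nat (Suc L)"] by simp
  qed
  then have lim: "(\<lambda>L. prob (U L)) \<longlonglongrightarrow> prob (\<Union>L. U L)"
    by (intro finite_Lim_measure_incseq) auto
  have "AE y in M. y \<in> (\<Union>L. U L)"
    using fin AE_space
  proof eventually_elim
    case (elim y)
    then obtain L where "u y < of_nat L"
      using ennreal_Ex_less_of_nat[of "u y"] by (auto simp: less_top)
    then show ?case using elim unfolding U_def by (auto intro!: exI[of _ L] less_imp_le)
  qed
  then have "prob (\<Union>L. U L) = 1" by (subst prob_eq_1) auto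
  with lim have "\<forall>\<^sub>F L in sequentially. prob (U L) > 1 - \<eta> / 2"
    using \<eta>(1) by (intro order_tendstoD(1)) auto
  then obtain L where L: "prob (U L) > 1 - \<eta> / 2"
    by (auto simp: eventually_sequentially)
  have half: "\<eta> / 2 \<le> prob (E j \<inter> U L)" for j
  proof -
    have "prob (E j \<union> U L) = prob (E j) + prob (U L) - prob (E j \<inter> U L)"
      using measure_Un3[of "E j" M "U L"] by (simp add: fmeasurable_eq_sets)
    then show ?thesis using \<eta>(2)[of j] L prob_le_1[of "E j \<union> U L"] by linarith
  qed
  obtain K where K: "2 * real L / \<eta> < (\<Sum>j\<le>K. v K j)" using unb by blast
  have int: "integrable M (indicat_real (E j \<inter> U L))" for j
    by (intro integrable_real_indicator) (auto simp: less_top[symmetric])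
  have "(\<Sum>j\<le>K. v K j) * (\<eta> / 2) \<le> (\<Sum>j\<le>K. v K j * prob (E j \<inter> U L))"
    unfolding sum_distrib_right using half v by (intro sum_mono mult_left_mono) auto
  also have "\<dots> = (\<integral>y. (\<Sum>j\<le>K. v K j * indicator (E j \<inter> U L) y) \<partial>M)"
    by (subst Bochner_Integration.integral_sum) (auto simp: int)
  also have "\<dots> \<le> (\<integral>y. real L \<partial>M)"
  proof (intro integral_mono)
    show "integrable M (\<lambda>y. \<Sum>j\<le>K. v K j * indicat_real (E j \<inter> U L) y)"
      by (intro Bochner_Integration.integrable_sum integrable_mult_right int)
    show "integrable M (\<lambda>y. real L)" by simp
    fix y assume y: "y \<in> space M"
    show "(\<Sum>j\<le>K. v K j * indicator (E j \<inter> U L) y) \<le> real L"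
    proof (cases "y \<in> U L")
      case True
      have "ennreal (\<Sum>j\<le>K. v K j * indicator (E j) y) \<le> ennreal (real L)"
        using True unfolding U_def
        by (intro order.trans[OF le[OF y]]) (simp add: ennreal_of_nat_eq_real_of_nat)
      then show ?thesis using True by (simp add: indicator_inter_arith)
    qed simp
  qed
  finally have "(\<Sum>j\<le>K. v K j) * (\<eta> / 2) \<le> real L" by (simp add: prob_space)
  then show False using K \<eta>(1) by (simp add: field_simps)
qed


text \<open>
  The jumps of the step function that takes the values \<open>b 0, \<dots>, b K\<close> and then drops to \<open>0\<close>.
\<close>

definition step_weight :: "(nat \<Rightarrow> real) \<Rightarrow> nat \<Rightarrow> nat \<Rightarrow> real" where
  "step_weight b K j = (if j < K then b j - b (Suc j) else b K)"

text \<open>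
  Replacing \<open>K\<close> by \<open>K + 1\<close> only splits the last jump \<open>b K\<close> into \<open>b K - b (K + 1)\<close> and
  \<open>b (K + 1)\<close>; the next two facts are inductions over this step.
\<close>

lemma sum_step_weight_Suc:
  "(\<Sum>j\<le>Suc K. step_weight b (Suc K) j * s j)
     = (\<Sum>j\<le>K. step_weight b K j * s j) + b (Suc K) * (s (Suc K) - s K)"
proof -
  have "(\<Sum>j<K. step_weight b (Suc K) j * s j) = (\<Sum>j<K. step_weight b K j * s j)"
    by (intro sum.cong) (auto simp: step_weight_def)
  then show ?thesis
    by (simp add: lessThan_Suc_atMost[symmetric] step_weight_def algebra_simps)
qed

lemma sum_step_weight_partial_sums:
  "(\<Sum>j\<le>K. step_weight b K j * (\<Sum>i\<le>j. a i)) = (\<Sum>j\<le>K. b j * a j)"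
proof (induction K)
  case 0
  show ?case by (simp add: step_weight_def)
next
  case (Suc K)
  show ?case
    by (subst sum_step_weight_Suc) (simp add: Suc.IH)
qed

text \<open>
  On each block of times between \<open>n K\<close> and \<open>n (K + 1)\<close> the step function is constant and, as \<open>\<omega>\<close> is
  nonincreasing, stays below \<open>\<omega>\<close>.
\<close>

lemma sum_step_weight_card_le:
  fixes \<omega> :: "real \<Rightarrow> real" and n :: "nat \<Rightarrow> nat"
  assumes anti: "antimono_on {0<..} \<omega>" and n: "incseq n" "\<And>j. n j > 0"
  shows "(\<Sum>j\<le>K. step_weight (\<lambda>j. \<omega> (real (n j))) K j * real (card (J \<inter> {1..n j})))
    \<le> (\<Sum>i\<in>J \<inter> {1..n K}. \<omega> (real i))"
proof -
  have block: "\<omega> (real q) * real (card (J \<inter> {p<..q})) \<le> (\<Sum>i\<in>J \<inter> {p<..q}. \<omega> (real i))" for p q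
  proof -
    have "(\<Sum>i\<in>J \<inter> {p<..q}. \<omega> (real q)) \<le> (\<Sum>i\<in>J \<inter> {p<..q}. \<omega> (real i))"
      using anti by (intro sum_mono) (auto simp: monotone_on_def)
    then show ?thesis by (simp add: mult.commute)
  qed
  show ?thesis
  proof (induction K)
    case 0
    have "{0<..n 0} = {1..n 0}" by auto
    then show ?case using block[of "n 0" 0] by (simp add: step_weight_def)
  next
    case (Suc K)
    have le: "n K \<le> n (Suc K)" using n(1) by (simp add: incseq_SucD)
    have split: "J \<inter> {1..n (Suc K)} = (J \<inter> {1..n K}) \<union> (J \<inter> {n K<..n (Suc K)})"
      using le by auto
    have disj: "(J \<inter> {1..n K}) \<inter> (J \<inter> {n K<..n (Suc K)}) = {}" by auto
    have "card (J \<inter> {1..n (Suc K)}) = card (J \<inter> {1..n K}) + card (J \<inter> {n K<..n (Suc K)})"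
      unfolding split using disj by (intro card_Un_disjoint) auto
    moreover have "(\<Sum>i\<in>J \<inter> {1..n (Suc K)}. \<omega> (real i))
        = (\<Sum>i\<in>J \<inter> {1..n K}. \<omega> (real i)) + (\<Sum>i\<in>J \<inter> {n K<..n (Suc K)}. \<omega> (real i))"
      unfolding split using disj by (intro sum.union_disjoint) auto
    ultimately show ?case
      using Suc.IH block[of "n (Suc K)" "n K"] by (subst sum_step_weight_Suc) simp
  qed
qed

text \<open>
  Abel summation is used in both directions: pointwise, to bound the weighted sum below by the counts
  up to the times \<open>n j\<close>, and on the side of the weights, where the comparison of \<open>a j\<close> with the partial sums of
  \<open>a\<close> turns \<open>\<Sum>\<^sub>j w\<^sub>j a\<^sub>j\<close> back into the divergent series.
\<close>

lemma not_AE_finite_of_frequent_times: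
  fixes \<omega> :: "real \<Rightarrow> real" and n :: "nat \<Rightarrow> nat" and a :: "nat \<Rightarrow> real"
    and J :: "'a \<Rightarrow> nat set"
  assumes M: "prob_space M" and J: "\<And>i. {y \<in> space M. i \<in> J y} \<in> sets M"
    and pos: "\<forall>x>0. \<omega> x > 0" and anti: "antimono_on {0<..} \<omega>"
    and n: "incseq n" "\<And>j. n j > 0" and a: "\<And>j. a j > 0"
    and c: "c > 0" "\<And>j. c * (\<Sum>i\<le>j. a i) \<le> a j"
    and diverge: "\<And>L. \<exists>K. L < (\<Sum>j\<le>K. \<omega> (real (n j)) * a j)"
    and \<eta>: "\<eta> > 0" "\<And>j. \<eta> \<le> measure M {y \<in> space M. a j \<le> real (card (J y \<inter> {1..n j}))}"
  shows "\<not> (AE y in M. (\<Sum>i. indicator (J y) i * ennreal (\<omega> (real i))) \<noteq> \<infinity>)"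
proof -
  let ?b = "\<lambda>j. \<omega> (real (n j))"
  let ?w = "step_weight ?b"
  let ?E = "\<lambda>j. {y \<in> space M. a j \<le> real (card (J y \<inter> {1..n j}))}"
  note J [measurable]
  have w: "?w K j \<ge> 0" for K j
  proof -
    have "?b (Suc j) \<le> ?b j"
      using anti n by (auto simp: monotone_on_def incseq_SucD)
    moreover have "?b K \<ge> 0" using pos n by (simp add: less_imp_le)
    ultimately show ?thesis by (simp add: step_weight_def)
  qed
  have card_eq: "real (card (J y \<inter> {1..N})) = (\<Sum>i\<in>{1..N}. if i \<in> J y then 1 else 0)" for y N
    by (simp add: sum.If_cases Int_def conj_commute)
  show ?thesis
  proof (rule not_AE_finite_of_weighted_events[OF M, where E = ?E and v = "\<lambda>K j. ?w K j * a j" and \<eta> = \<eta>])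
    show "?E j \<in> sets M" for j
      unfolding card_eq by measurable
    show "0 < \<eta>" "\<eta> \<le> measure M (?E j)" for j by (fact \<eta>)+
    show "0 \<le> ?w K j * a j" for K j using w a[of j] by simp
    show "\<exists>K. L < (\<Sum>j\<le>K. ?w K j * a j)" for L
    proof -
      obtain K where K: "L / c < (\<Sum>j\<le>K. ?b j * a j)" using diverge by blast
      have "c * (\<Sum>j\<le>K. ?b j * a j) = (\<Sum>j\<le>K. ?w K j * (c * (\<Sum>i\<le>j. a i)))"
        by (subst sum_step_weight_partial_sums[symmetric], subst sum_distrib_left, intro sum.cong)
          (simp_all only: mult.left_commute)
      also have "\<dots> \<le> (\<Sum>j\<le>K. ?w K j * a j)"
        using w c(2) by (intro sum_mono mult_left_mono) auto
      finally show ?thesis using K c(1) by (intro exI[of _ K]) (simp add: field_simps)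
    qed
    have "indicator (J y) i * ennreal (\<omega> (real i)) = (if i \<in> J y then ennreal (\<omega> (real i)) else 0)" for y i
      by simp
    then show "(\<lambda>y. \<Sum>i. indicator (J y) i * ennreal (\<omega> (real i))) \<in> borel_measurable M"
      by simp
    fix K y assume "y \<in> space M"
    have "(\<Sum>j\<le>K. ?w K j * a j * indicator (?E j) y)
        \<le> (\<Sum>j\<le>K. ?w K j * real (card (J y \<inter> {1..n j})))"
      unfolding mult.assoc using w by (intro sum_mono mult_left_mono) (auto simp: indicator_def)
    also have "\<dots> \<le> (\<Sum>i\<in>J y \<inter> {1..n K}. \<omega> (real i))"
      by (rule sum_step_weight_card_le[OF anti n])
    finally have "ennreal (\<Sum>j\<le>K. ?w K j * a j * indicator (?E j) y)
        \<le> ennreal (\<Sum>i\<in>J y \<inter> {1..n K}. \<omega> (real i))"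
      by (rule ennreal_leI)
    also have "\<dots> = (\<Sum>i\<in>J y \<inter> {1..n K}. indicator (J y) i * ennreal (\<omega> (real i)))"
      using pos by (subst sum_ennreal[symmetric]) (auto simp: less_imp_le)
    also have "\<dots> \<le> (\<Sum>i. indicator (J y) i * ennreal (\<omega> (real i)))"
      by (intro sum_le_suminf) auto
    finally show "ennreal (\<Sum>j\<le>K. ?w K j * a j * indicator (?E j) y)
        \<le> (\<Sum>i. indicator (J y) i * ennreal (\<omega> (real i)))" .
  qed
qed

section \<open>Returns of the cocycle to the identity\<close>

text \<open>
  In a single fibre of \<open>c\<close>, the points with at most \<open>t\<close> fibre members at or after them are all
  counted from the first such point, so there are at most \<open>t\<close> of them.
\<close>

lemma card_few_later_recurrences:
  fixes I :: "nat set" and t :: real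
  assumes I: "finite I" and t: "t \<ge> 0"
  shows "real (card {n \<in> I. real (card {m \<in> I. n \<le> m \<and> c m = c n}) \<le> t}) \<le> real (card (c ` I)) * t"
proof -
  let ?L = "\<lambda>n. {m \<in> I. n \<le> m \<and> c m = c n}"
  let ?P = "{n \<in> I. real (card (?L n)) \<le> t}"
  have fibre: "real (card {n \<in> ?P. c n = v}) \<le> t" for v
  proof (cases "{n \<in> ?P. c n = v} = {}")
    case False
    define n0 where "n0 = Min {n \<in> ?P. c n = v}"
    have n0: "n0 \<in> {n \<in> ?P. c n = v}"
      unfolding n0_def using I False by (intro Min_in) auto
    have "{n \<in> ?P. c n = v} \<subseteq> ?L n0"
      using n0 I unfolding n0_def by (auto intro!: Min_le)
    then have "card {n \<in> ?P. c n = v} \<le> card (?L n0)"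
      using I by (intro card_mono) auto
    then show ?thesis using n0 by auto
  qed (use t in \<open>simp only: card.empty of_nat_0\<close>)
  define F where "F v = {n \<in> ?P. c n = v}" for v
  have "?P = (\<Union>v\<in>c ` I. F v)" unfolding F_def by auto
  then have "card ?P \<le> (\<Sum>v\<in>c ` I. card (F v))"
    using I card_UN_le[of "c ` I" F] by simp
  then have "real (card ?P) \<le> (\<Sum>v\<in>c ` I. real (card (F v)))"
    unfolding of_nat_sum[symmetric] of_nat_le_iff .
  also have "\<dots> \<le> (\<Sum>v\<in>c ` I. t)" using fibre unfolding F_def by (intro sum_mono)
  finally show ?thesis by simp
qed

text \<open>
  These are the times at which the orbit of \<open>(y, e)\<close> under the skew product lies in \<open>B \<times> {e}\<close>.
\<close>

definition return_times ::
  "('g, 'b) monoid_scheme \<Rightarrow> ('y \<Rightarrow> 'y) \<Rightarrow> ('y \<Rightarrow> 'g) \<Rightarrow> 'y set \<Rightarrow> 'y \<Rightarrow> nat set" where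
  "return_times G S f B y = {i. cocycle_prod G S f i y = \<one>\<^bsub>G\<^esub> \<and> (S ^^ i) y \<in> B}"

lemma skew_product_funpow_one:
  "(skew_product G S f ^^ i) (y, \<one>\<^bsub>G\<^esub>) = ((S ^^ i) y, cocycle_prod G S f i y)"
  by (induction i) (simp_all add: skew_product_def)

lemma cocycle_prod_closed:
  assumes "group G" "\<And>i. f ((S ^^ i) y) \<in> carrier G"
  shows "cocycle_prod G S f i y \<in> carrier G"
proof -
  interpret group G by fact
  show ?thesis using assms(2) by (induction i) auto
qed

lemma cocycle_prod_add:
  assumes G: "group G" and f: "\<And>i. f ((S ^^ i) y) \<in> carrier G"
  shows "cocycle_prod G S f (n + i) y = cocycle_prod G S f n y \<otimes>\<^bsub>G\<^esub> cocycle_prod G S f i ((S ^^ n) y)"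
proof -
  interpret group G by fact
  have f': "f ((S ^^ i) ((S ^^ n) y)) \<in> carrier G" for i
    using f[of "i + n"] by (simp add: funpow_add)
  have [simp]: "cocycle_prod G S f j y \<in> carrier G"
      "cocycle_prod G S f j ((S ^^ n) y) \<in> carrier G" for j
    using f f' by (auto intro!: cocycle_prod_closed[OF G])
  note [simp] = f'
  show ?thesis
    by (induction i) (auto simp: m_assoc funpow_add add.commute[of n])
qed

text \<open>
  Take \<open>t = N / (2 \<rho>)\<close> in the fibre count: among the times \<open>n \<le> N\<close> with \<open>S\<^sup>n y \<in> B\<close>, at most
  \<open>\<rho> t = N / 2\<close> have few later repetitions of their cocycle value. Every other such \<open>n\<close> has more than
  \<open>t - 1 \<ge> t / 2\<close> strictly later repetitions, which are returns of \<open>S\<^sup>n y\<close>. The condition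
  \<open>N / \<rho> \<ge> 4\<close> makes room for the \<open>-1\<close>, which comes from \<open>n\<close> itself.
\<close>

lemma card_window_le_frequent_returns:
  fixes \<rho> :: real
  assumes G: "group G" and f: "\<And>i. f ((S ^^ i) y) \<in> carrier G"
    and \<rho>: "\<rho> > 0" "real (range_count G S f N y) \<le> \<rho>" and N: "real N / \<rho> \<ge> 4"
  shows "real N \<le> 2 * (real (card {n \<in> {1..N}.
             real N / \<rho> / 4 \<le> real (card (return_times G S f B ((S ^^ n) y) \<inter> {1..N}))})
           + real (card {n \<in> {1..N}. (S ^^ n) y \<notin> B}))"
proof -
  interpret group G by fact
  define t where "t = real N / \<rho> / 2"
  have t: "t \<ge> 2" using N unfolding t_def by simp
  define I where "I = {n \<in> {1..N}. (S ^^ n) y \<in> B}"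
  have I: "finite I" unfolding I_def by simp
  let ?c = "\<lambda>n. cocycle_prod G S f n y"
  let ?L = "\<lambda>n. {m \<in> I. n \<le> m \<and> ?c m = ?c n}"
  let ?P = "{n \<in> I. real (card (?L n)) \<le> t}"
  let ?R = "\<lambda>n. return_times G S f B ((S ^^ n) y) \<inter> {1..N}"
  let ?E = "{n \<in> {1..N}. real N / \<rho> / 4 \<le> real (card (?R n))}"
  let ?O = "{n \<in> {1..N}. (S ^^ n) y \<notin> B}"
  have "card (?c ` I) \<le> range_count G S f N y"
    unfolding range_count_def I_def by (intro card_mono) auto
  then have "real (card (?c ` I)) \<le> \<rho>" using \<rho>(2) by linarith
  then have "real (card (?c ` I)) * t \<le> \<rho> * t" using t by (intro mult_right_mono) auto
  moreover have "real (card ?P) \<le> real (card (?c ` I)) * t"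
    using t by (intro card_few_later_recurrences[OF I]) simp
  moreover have "\<rho> * t = real N / 2" using \<rho>(1) unfolding t_def by simp
  ultimately have P: "real (card ?P) \<le> real N / 2" by linarith
  have later: "card (?L n) \<le> card (?R n) + 1" if n: "n \<in> I" for n
  proof -
    have f': "f ((S ^^ i) ((S ^^ n) y)) \<in> carrier G" for i
      using f[of "i + n"] by (simp add: funpow_add)
    have "?L n \<subseteq> insert n ((\<lambda>i. n + i) ` ?R n)"
    proof
      fix m assume m: "m \<in> ?L n"
      show "m \<in> insert n ((\<lambda>i. n + i) ` ?R n)"
      proof (cases "m = n")
        case False
        define i where "i = m - n"
        have i: "m = n + i" "i \<ge> 1" "i \<le> N" using m False unfolding i_def I_def by auto
        have "?c n \<otimes>\<^bsub>G\<^esub> cocycle_prod G S f i ((S ^^ n) y) = ?c n"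
          using m i(1) cocycle_prod_add[where f = f and S = S and y = y and n = n and i = i, OF G f] by simp
        then have "cocycle_prod G S f i ((S ^^ n) y) = \<one>\<^bsub>G\<^esub>"
          using cocycle_prod_closed[where f = f and S = S and y = y and i = n, OF G f]
            cocycle_prod_closed[where f = f and S = S and y = "(S ^^ n) y" and i = i, OF G f']
          by simp
        moreover have "(S ^^ i) ((S ^^ n) y) \<in> B"
          using m i(1) unfolding I_def by (simp add: funpow_add add.commute[of n])
        ultimately show ?thesis using i unfolding return_times_def by auto
      qed simp
    qed
    then have "card (?L n) \<le> card (insert n ((\<lambda>i. n + i) ` ?R n))"
      by (intro card_mono) auto
    also have "\<dots> \<le> Suc (card ((\<lambda>i. n + i) ` ?R n))"
      by (simp add: card_insert_if)
    also have "\<dots> = card (?R n) + 1"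
      by (simp add: card_image)
    finally show ?thesis .
  qed
  have "{1..N} \<subseteq> ?P \<union> ?E \<union> ?O"
  proof
    fix n assume n: "n \<in> {1..N}"
    show "n \<in> ?P \<union> ?E \<union> ?O"
    proof (cases "n \<in> I \<and> n \<notin> ?P")
      case True
      then have "t < real (card (?L n))" by auto
      also have "\<dots> \<le> real (card (?R n)) + 1" using later[of n] True by linarith
      finally have "real N / \<rho> / 4 \<le> real (card (?R n))" using t unfolding t_def by argo
      then show ?thesis using n by simp
    next
      case False
      then show ?thesis using n unfolding I_def by auto
    qed
  qed
  then have "card {1..N} \<le> card (?P \<union> ?E \<union> ?O)"
    using I by (intro card_mono) auto
  also have "\<dots> \<le> card ?P + card ?E + card ?O"
    using card_Un_le[of "?P \<union> ?E" ?O] card_Un_le[of ?P ?E] by linarith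
  finally have "real N \<le> real (card ?P) + real (card ?E) + real (card ?O)" by simp
  then show ?thesis using P by argo
qed

lemma expected_visits:
  assumes M: "prob_space M" and S: "measure_preserving M S" and E: "E \<in> sets M"
  shows "integrable M (\<lambda>y. real (card {n \<in> {1..N}. (S ^^ n) y \<in> E}))"
    and "(\<integral>y. real (card {n \<in> {1..N}. (S ^^ n) y \<in> E}) \<partial>M) = real N * measure M E"
proof -
  interpret prob_space M by fact
  let ?A = "\<lambda>n. (S ^^ n) -` E \<inter> space M"
  have Sm: "S \<in> M \<rightarrow>\<^sub>M M" using S unfolding measure_preserving_def by auto
  have A: "?A n \<in> sets M" for n using E measurable_compose_n[OF Sm] by (rule measurable_sets[rotated])
  have eq: "real (card {n \<in> {1..N}. (S ^^ n) y \<in> E}) = (\<Sum>n\<in>{1..N}. indicator (?A n) y)"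
    if "y \<in> space M" for y
    using that by (simp add: indicator_def sum.If_cases Int_def conj_commute)
  have int: "integrable M (indicat_real (?A n))" for n
    using A by (intro integrable_real_indicator) (auto simp: less_top[symmetric])
  then have "integrable M (\<lambda>y. \<Sum>n\<in>{1..N}. indicat_real (?A n) y)"
    by (intro Bochner_Integration.integrable_sum)
  then show "integrable M (\<lambda>y. real (card {n \<in> {1..N}. (S ^^ n) y \<in> E}))"
    using eq by (subst Bochner_Integration.integrable_cong[OF refl]) auto
  have "(\<integral>y. real (card {n \<in> {1..N}. (S ^^ n) y \<in> E}) \<partial>M) = (\<integral>y. (\<Sum>n\<in>{1..N}. indicat_real (?A n) y) \<partial>M)"
    using eq by (intro Bochner_Integration.integral_cong) auto
  also have "\<dots> = (\<Sum>n\<in>{1..N}. measure M (?A n))"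
    using int A by (subst Bochner_Integration.integral_sum) auto
  also have "\<dots> = real N * measure M E"
    by (simp add: measure_preserving_funpow[OF S E])
  finally show "(\<integral>y. real (card {n \<in> {1..N}. (S ^^ n) y \<in> E}) \<partial>M) = real N * measure M E" .
qed

text \<open>
  The pointwise count is integrated over \<open>y\<close>; by invariance of the measure, each of the \<open>N\<close> times \<open>n\<close>
  contributes equally.
\<close>

lemma measure_frequent_returns:
  fixes \<rho> :: real
  assumes M: "prob_space M" and S: "measure_preserving M S"
    and G: "group G" and f: "f \<in> space M \<rightarrow> carrier G"
    and B: "B \<in> sets M"
    and J: "\<And>i. {y \<in> space M. i \<in> return_times G S f B y} \<in> sets M"
    and N: "N > 0" and \<rho>: "\<rho> > 0" "real N / \<rho> \<ge> 4"
    and R: "{y \<in> space M. real (range_count G S f N y) \<le> \<rho>} \<in> sets M" (is "?R \<in> _")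
  shows "measure M {y \<in> space M. real (range_count G S f N y) \<le> \<rho>} / 2 - (1 - measure M B)
    \<le> measure M {y \<in> space M. real N / \<rho> / 4 \<le> real (card (return_times G S f B y \<inter> {1..N}))}"
    (is "_ \<le> measure M ?E")
proof -
  interpret prob_space M by fact
  have Sm: "S \<in> M \<rightarrow>\<^sub>M M" using S unfolding measure_preserving_def by auto
  note Ssp = measurable_space[OF measurable_compose_n[OF Sm]]
  note J [measurable]
  have card_eq: "real (card (return_times G S f B y \<inter> {1..N}))
      = (\<Sum>i\<in>{1..N}. if i \<in> return_times G S f B y then 1 else 0)" for y
    by (simp add: sum.If_cases Int_def conj_commute)
  have E: "?E \<in> sets M" unfolding card_eq by measurable
  have Bc: "space M - B \<in> sets M" using B by auto
  let ?e = "\<lambda>y. real (card {n \<in> {1..N}. (S ^^ n) y \<in> ?E})"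
  let ?o = "\<lambda>y. real (card {n \<in> {1..N}. (S ^^ n) y \<in> space M - B})"
  have "real N * measure M ?R = (\<integral>y. real N * indicator ?R y \<partial>M)"
    using R by simp
  also have "\<dots> \<le> (\<integral>y. 2 * (?e y + ?o y) \<partial>M)"
  proof (intro integral_mono)
    show "integrable M (\<lambda>y. real N * indicat_real ?R y)"
      using R by (intro integrable_mult_right integrable_real_indicator) (auto simp: less_top[symmetric])
    show "integrable M (\<lambda>y. 2 * (?e y + ?o y))"
      by (intro integrable_mult_right Bochner_Integration.integrable_add expected_visits[OF M S] E Bc)
    fix y assume y: "y \<in> space M"
    show "real N * indicator ?R y \<le> 2 * (?e y + ?o y)"
    proof (cases "y \<in> ?R")
      case True
      have "f ((S ^^ i) y) \<in> carrier G" for i using f Ssp[OF y] by auto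
      from card_window_le_frequent_returns[of G f S, OF G this \<rho>(1) _ \<rho>(2), of B]
      show ?thesis using True Ssp[OF y] by simp
    qed simp
  qed
  also have "\<dots> = 2 * (real N * measure M ?E + real N * measure M (space M - B))"
    using expected_visits[OF M S E, of N] expected_visits[OF M S Bc, of N] by simp
  also have "\<dots> = real N * (2 * (measure M ?E + (1 - measure M B)))"
    unfolding prob_compl[OF B] by (simp add: algebra_simps)
  finally have "measure M ?R \<le> 2 * (measure M ?E + (1 - measure M B))"
    using N by simp
  moreover have "r / 2 - (1 - b) \<le> e" if "r \<le> 2 * (e + (1 - b))" for r e b :: real
    using that by argo
  ultimately show ?thesis by blast
qed


section \<open>Recurrence of the skew product\<close>

lemma skew_product_measurable:
  assumes G: "group G" "countable (carrier G)"
    and S: "S \<in> M \<rightarrow>\<^sub>M M" and f: "f \<in> M \<rightarrow>\<^sub>M count_space (carrier G)"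
  shows "skew_product G S f \<in> M \<Otimes>\<^sub>M count_space (carrier G) \<rightarrow>\<^sub>M M \<Otimes>\<^sub>M count_space (carrier G)"
proof -
  interpret group G by fact
  note S [measurable] f [measurable]
  have "(\<lambda>x. (\<lambda>g x. (S (fst x), g \<otimes>\<^bsub>G\<^esub> f (fst x))) (snd x) x)
      \<in> M \<Otimes>\<^sub>M count_space (carrier G) \<rightarrow>\<^sub>M M \<Otimes>\<^sub>M count_space (carrier G)"
  proof (rule measurable_compose_countable'[where I = "carrier G" and g = snd
        and f = "\<lambda>g x. (S (fst x), g \<otimes>\<^bsub>G\<^esub> f (fst x))"])
    fix g assume g: "g \<in> carrier G"
    have [measurable]: "(\<lambda>v. g \<otimes>\<^bsub>G\<^esub> v) \<in> count_space (carrier G) \<rightarrow>\<^sub>M count_space (carrier G)"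
      using g by auto
    show "(\<lambda>x. (S (fst x), g \<otimes>\<^bsub>G\<^esub> f (fst x)))
        \<in> M \<Otimes>\<^sub>M count_space (carrier G) \<rightarrow>\<^sub>M M \<Otimes>\<^sub>M count_space (carrier G)"
      by measurable
  qed (use G in simp_all)
  then show ?thesis by (simp add: skew_product_def case_prod_unfold)
qed

lemma AE_section_of_AE_pair_count_space:
  assumes M: "sigma_finite_measure M" and C: "countable C" "g \<in> C"
    and ae: "AE x in M \<Otimes>\<^sub>M count_space C. P x"
  shows "AE y in M. P (y, g)"
proof -
  interpret pair_sigma_finite M "count_space C"
    by (intro pair_sigma_finite.intro M sigma_finite_measure_count_space_countable C)
  have "AE y in M. AE g in count_space C. P (y, g)" using ae by (rule AE_pair)
  then show ?thesis by eventually_elim (use C(2) in \<open>simp add: AE_count_space\<close>)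
qed

lemma exists_large_hitting_set:
  assumes M: "prob_space M" and meas: "\<And>m. {y \<in> space M. Q m y} \<in> sets M"
    and ae: "AE y in M. \<exists>m. Q m y" and \<epsilon>: "\<epsilon> > 0"
  shows "\<exists>n. 1 - \<epsilon> \<le> measure M {y \<in> space M. \<exists>m\<le>n::nat. Q m y}"
proof -
  interpret prob_space M by fact
  note meas [measurable]
  let ?B = "\<lambda>n. {y \<in> space M. \<exists>m\<le>n. Q m y}"
  have B: "?B n \<in> sets M" for n by measurable
  have "incseq ?B" by (intro incseq_SucI subsetI) (auto intro: le_SucI)
  then have lim: "(\<lambda>n. prob (?B n)) \<longlonglongrightarrow> prob (\<Union>n. ?B n)"
    using B by (intro finite_Lim_measure_incseq) auto
  have "AE y in M. y \<in> (\<Union>n. ?B n)" using ae AE_space by eventually_elim auto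
  then have "prob (\<Union>n. ?B n) = 1" using B by (subst prob_eq_1) auto
  with lim have "\<forall>\<^sub>F n in sequentially. prob (?B n) > 1 - \<epsilon>"
    using \<epsilon> by (intro order_tendstoD(1)) auto
  then show ?thesis by (auto simp: eventually_sequentially intro: less_imp_le)
qed

lemma ennreal_series_tail_unbounded:
  fixes h :: "nat \<Rightarrow> real"
  assumes h: "\<And>k. k \<ge> 1 \<Longrightarrow> h k \<ge> 0" and inf: "(\<Sum>k. ennreal (h (Suc k))) = \<infinity>" and k0: "k0 \<ge> 1"
  shows "\<exists>K. L < (\<Sum>j\<le>K. h (k0 + j))"
proof (rule ccontr)
  assume "\<nexists>K. L < (\<Sum>j\<le>K. h (k0 + j))"
  then have bound: "(\<Sum>j\<le>K. h (k0 + j)) \<le> L" for K by (meson not_less)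
  have "(\<Sum>j<K. ennreal (h (k0 + j))) \<le> ennreal L" for K
  proof -
    have "(\<Sum>j<K. ennreal (h (k0 + j))) = ennreal (\<Sum>j<K. h (k0 + j))"
      using h k0 by (intro sum_ennreal) auto
    also have "\<dots> \<le> ennreal (\<Sum>j\<le>K. h (k0 + j))"
      using h k0 by (intro ennreal_leI sum_mono2) auto
    also have "\<dots> \<le> ennreal L" by (intro ennreal_leI bound)
    finally show ?thesis .
  qed
  then have tail: "(\<Sum>j. ennreal (h (k0 + j))) \<le> ennreal L"
    unfolding suminf_eq_SUP by (intro SUP_least) auto
  have "(\<Sum>k. ennreal (h (Suc k)))
      = (\<Sum>j. ennreal (h (Suc (j + (k0 - 1))))) + (\<Sum>k<k0 - 1. ennreal (h (Suc k)))"
    by (rule suminf_offset) simp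
  also have "(\<lambda>j. ennreal (h (Suc (j + (k0 - 1))))) = (\<lambda>j. ennreal (h (k0 + j)))"
    using k0 by (auto simp: add.commute)
  finally have "\<infinity> \<le> ennreal L + (\<Sum>k<k0 - 1. ennreal (h (Suc k)))"
    using inf tail by (metis add_right_mono)
  then show False by (simp add: top_unique)
qed

text \<open>
  Adding \<open>\<delta> a\<^sub>j\<close> on both sides of the growth condition includes the last term in the sum, at the price of
  replacing \<open>\<delta>\<close> by \<open>\<delta> / (1 + \<delta>)\<close>.
\<close>

lemma growth_tail:
  fixes a :: "nat \<Rightarrow> real"
  assumes \<delta>: "\<delta> > 0" and a: "\<And>k. k \<ge> 1 \<Longrightarrow> a k > 0"
    and growth: "\<And>k. k \<ge> k0 \<Longrightarrow> a k \<ge> \<delta> * (\<Sum>i\<in>{1..<k}. a i)" and k0: "k0 \<ge> 1"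
  shows "\<delta> / (1 + \<delta>) * (\<Sum>i\<le>j. a (k0 + i)) \<le> a (k0 + j)"
proof -
  have "(\<Sum>i<j. a (k0 + i)) = (\<Sum>i\<in>(\<lambda>i. k0 + i) ` {..<j}. a i)"
    by (subst sum.reindex) auto
  also have "\<dots> \<le> (\<Sum>i\<in>{1..<k0 + j}. a i)"
    using a k0 by (intro sum_mono2) (auto intro: less_imp_le)
  finally have "\<delta> * (\<Sum>i<j. a (k0 + i)) \<le> \<delta> * (\<Sum>i\<in>{1..<k0 + j}. a i)"
    using \<delta> by (intro mult_left_mono) auto
  also have "\<dots> \<le> a (k0 + j)" by (rule growth) simp
  finally have "\<delta> * (\<Sum>i\<le>j. a (k0 + i)) \<le> (1 + \<delta>) * a (k0 + j)"
    by (simp add: lessThan_Suc_atMost[symmetric] algebra_simps)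
  then show ?thesis using \<delta> by (simp add: field_simps)
qed

theorem theorem2p5:
  fixes \<nu> :: "'y measure" and S :: "'y \<Rightarrow> 'y"
    and G :: "('g, 'b) monoid_scheme" and f :: "'y \<Rightarrow> 'g"
    and N :: "nat \<Rightarrow> nat" and \<rho> :: "nat \<Rightarrow> real" and \<epsilon>\<^sub>1 :: real
    and \<mu> :: "('y \<times> 'g) measure" and T :: "'y \<times> 'g \<Rightarrow> 'y \<times> 'g"
  defines "\<mu> \<equiv> \<nu> \<Otimes>\<^sub>M count_space (carrier G)"
    and "T \<equiv> skew_product G S f"
  assumes "prob_space \<nu>"
    and "measure_preserving \<nu> S"
    and "ergodic \<nu> S"
    and "group G"
    and "countable (carrier G)"
    and "f \<in> \<nu> \<rightarrow>\<^sub>M count_space (carrier G)"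
    and "conservative \<mu> T"
    and "ergodic \<mu> T"
    and "strict_mono_on {1..} N"
    and "\<And>k. k \<ge> 1 \<Longrightarrow> N k > 0"
    and "0 < \<epsilon>\<^sub>1" and "\<epsilon>\<^sub>1 \<le> 1"
    and "\<And>k. k \<ge> 1 \<Longrightarrow> \<rho> k > 0"
    and "\<And>k. k \<ge> 1 \<Longrightarrow>
           measure \<nu> {y \<in> space \<nu>. real (range_count G S f (N k) y) \<le> \<rho> k} \<ge> \<epsilon>\<^sub>1"
    and "\<rho> \<in> o(\<lambda>k. real (N k))"
    and "\<exists>\<delta>>0. \<forall>\<^sub>F k in sequentially.
           real (N k) / \<rho> k \<ge> \<delta> * (\<Sum>i\<in>{1..<k}. real (N i) / \<rho> i)"
  shows "\<forall>\<omega> :: real \<Rightarrow> real.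
           (\<forall>x>0. \<omega> x > 0) \<and> antimono_on {0<..} \<omega> \<and> regularly_varying \<omega> \<and>
           (\<Sum>k. ennreal (\<omega> (real (N (Suc k))) * (real (N (Suc k)) / \<rho> (Suc k)))) = \<infinity>
           \<longrightarrow> omega_recurrent \<mu> T \<omega>"
proof (intro allI impI)
  fix \<omega> :: "real \<Rightarrow> real"
  assume \<omega>: "(\<forall>x>0. \<omega> x > 0) \<and> antimono_on {0<..} \<omega> \<and> regularly_varying \<omega> \<and>
    (\<Sum>k. ennreal (\<omega> (real (N (Suc k))) * (real (N (Suc k)) / \<rho> (Suc k)))) = \<infinity>"
  then have pos: "\<forall>x>0. \<omega> x > 0" and anti: "antimono_on {0<..} \<omega>" and rv: "regularly_varying \<omega>"
    and diverge: "(\<Sum>k. ennreal (\<omega> (real (N (Suc k))) * (real (N (Suc k)) / \<rho> (Suc k)))) = \<infinity>"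
    by blast+
  note prob = assms(3) and S = assms(4) and G = assms(6,7) and f = assms(8)
    and cons = assms(9) and erg = assms(10) and N_mono = assms(11) and N_pos = assms(12)
    and \<epsilon> = assms(13) and \<rho>_pos = assms(15) and few = assms(16) and small = assms(17)
  interpret prob_space \<nu> by (fact prob)
  interpret group G by (fact G(1))
  have Sm: "S \<in> \<nu> \<rightarrow>\<^sub>M \<nu>" using S unfolding measure_preserving_def by blast
  have T: "T \<in> \<mu> \<rightarrow>\<^sub>M \<mu>" unfolding T_def \<mu>_def by (rule skew_product_measurable[OF G Sm f])
  have T_one: "(T ^^ i) (y, \<one>\<^bsub>G\<^esub>) = ((S ^^ i) y, cocycle_prod G S f i y)" for i y
    unfolding T_def by (rule skew_product_funpow_one)
  have incl: "(\<lambda>y. (y, \<one>\<^bsub>G\<^esub>)) \<in> \<nu> \<rightarrow>\<^sub>M \<mu>" unfolding \<mu>_def by measurable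
  have visits: "{y \<in> space \<nu>. (T ^^ i) (y, \<one>\<^bsub>G\<^esub>) \<in> D} \<in> sets \<nu>" if "D \<in> sets \<mu>" for i D
    using measurable_sets[OF measurable_compose[OF incl measurable_compose_n[OF T, of i]] that]
    by (simp add: vimage_def Int_def conj_commute)

  obtain \<delta> where \<delta>: "\<delta> > 0"
    and growth: "\<forall>\<^sub>F k in sequentially. real (N k) / \<rho> k \<ge> \<delta> * (\<Sum>i\<in>{1..<k}. real (N i) / \<rho> i)"
    using assms(18) by blast
  have "\<forall>\<^sub>F k in sequentially. norm (\<rho> k) \<le> 1 / 4 * norm (real (N k))"
    using landau_o.smallD[OF small, of "1 / 4"] by simp
  with growth have "\<forall>\<^sub>F k in sequentially. norm (\<rho> k) \<le> 1 / 4 * norm (real (N k))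
      \<and> real (N k) / \<rho> k \<ge> \<delta> * (\<Sum>i\<in>{1..<k}. real (N i) / \<rho> i)"
    by eventually_elim blast
  then obtain k1 where k1: "\<And>k. k \<ge> k1 \<Longrightarrow> norm (\<rho> k) \<le> 1 / 4 * norm (real (N k))
      \<and> real (N k) / \<rho> k \<ge> \<delta> * (\<Sum>i\<in>{1..<k}. real (N i) / \<rho> i)"
    unfolding eventually_sequentially by blast
  \<comment> \<open>The scales start where \<open>N / \<rho> \<ge> 4\<close> and the growth condition hold; sequences are reindexed from \<open>k0\<close>.\<close>
  define k0 where "k0 = max 1 k1"
  have k0: "k0 \<ge> 1" "k0 \<ge> k1" unfolding k0_def by auto
  define n where "n j = N (k0 + j)" for j
  define a where "a j = real (N (k0 + j)) / \<rho> (k0 + j) / 4" for j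
  have a_pos: "a j > 0" for j using N_pos[of "k0 + j"] \<rho>_pos[of "k0 + j"] k0 unfolding a_def by simp
  have n_pos: "n j > 0" for j using N_pos[of "k0 + j"] k0 unfolding n_def by simp
  have "incseq n"
    using N_mono k0 unfolding n_def
    by (intro incseq_SucI) (auto simp: monotone_on_def intro!: less_imp_le)
  have a_growth: "\<delta> / (1 + \<delta>) * (\<Sum>i\<le>j. a i) \<le> a j" for j
  proof -
    have le: "\<delta> / (1 + \<delta>) * (\<Sum>i\<le>j. real (N (k0 + i)) / \<rho> (k0 + i)) \<le> real (N (k0 + j)) / \<rho> (k0 + j)"
      using N_pos \<rho>_pos k1 k0 by (intro growth_tail[OF \<delta>]) auto
    show ?thesis
      unfolding a_def sum_divide_distrib[symmetric]
      using divide_right_mono[OF le, of 4] by (simp del: divide_divide_eq_left)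
  qed
  have n_diverge: "\<exists>K. L < (\<Sum>j\<le>K. \<omega> (real (n j)) * a j)" for L
  proof -
    have "\<exists>K. 4 * L < (\<Sum>j\<le>K. \<omega> (real (N (k0 + j))) * (real (N (k0 + j)) / \<rho> (k0 + j)))"
    proof (rule ennreal_series_tail_unbounded[OF _ diverge k0(1)])
      fix k :: nat assume "k \<ge> 1"
      then show "\<omega> (real (N k)) * (real (N k) / \<rho> k) \<ge> 0"
        using pos N_pos[of k] \<rho>_pos[of k] by (simp add: less_imp_le)
    qed
    then obtain K where "4 * L < (\<Sum>j\<le>K. \<omega> (real (N (k0 + j))) * (real (N (k0 + j)) / \<rho> (k0 + j)))" ..
    moreover have "(\<Sum>j\<le>K. \<omega> (real (n j)) * a j)
        = (\<Sum>j\<le>K. \<omega> (real (N (k0 + j))) * (real (N (k0 + j)) / \<rho> (k0 + j))) / 4"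
      unfolding n_def a_def sum_divide_distrib by simp
    ultimately show ?thesis by (intro exI[of _ K]) simp
  qed

  show "omega_recurrent \<mu> T \<omega>"
    unfolding omega_recurrent_def
  proof (intro ballI impI)
    fix A assume A: "A \<in> sets \<mu>" and "0 < emeasure \<mu> A \<and> emeasure \<mu> A < \<infinity>"
    then have "A \<notin> null_sets \<mu>" by auto
    then have "AE x in \<mu>. \<exists>m. (T ^^ m) x \<in> A"
      by (rule AE_visits_of_conservative_ergodic[OF T cons erg A])
    then have ae: "AE y in \<nu>. \<exists>m. (T ^^ m) (y, \<one>\<^bsub>G\<^esub>) \<in> A"
      unfolding \<mu>_def
      by (rule AE_section_of_AE_pair_count_space[OF sigma_finite_measure_axioms G(2) one_closed])
    have "\<exists>l. 1 - \<epsilon>\<^sub>1 / 4 \<le> prob {y \<in> space \<nu>. \<exists>m\<le>l. (T ^^ m) (y, \<one>\<^bsub>G\<^esub>) \<in> A}"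
      by (rule exists_large_hitting_set[OF prob visits[OF A] ae]) (use \<epsilon> in simp)
    then obtain l where l: "1 - \<epsilon>\<^sub>1 / 4 \<le> prob {y \<in> space \<nu>. \<exists>m\<le>l. (T ^^ m) (y, \<one>\<^bsub>G\<^esub>) \<in> A}" ..
    define B where "B = {y \<in> space \<nu>. \<exists>m\<le>l. (T ^^ m) (y, \<one>\<^bsub>G\<^esub>) \<in> A}"
    have B: "B \<in> sets \<nu>"
    proof -
      note visits[OF A, measurable]
      show ?thesis unfolding B_def by measurable
    qed
    have "B \<times> {\<one>\<^bsub>G\<^esub>} \<in> sets \<mu>" unfolding \<mu>_def using B by (intro pair_measureI) auto
    from visits[OF this] have J: "{y \<in> space \<nu>. i \<in> return_times G S f B y} \<in> sets \<nu>" for i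
      by (simp add: T_one return_times_def conj_commute)
    have frequent: "\<epsilon>\<^sub>1 / 4 \<le> prob {y \<in> space \<nu>. a j \<le> real (card (return_times G S f B y \<inter> {1..n j}))}" for j
    proof -
      let ?k = "k0 + j"
      have k: "?k \<ge> 1" "?k \<ge> k1" using k0 by auto
      have "real (N ?k) / \<rho> ?k \<ge> 4"
        using k1[OF k(2)] \<rho>_pos[OF k(1)] by (simp add: field_simps)
      moreover have "{y \<in> space \<nu>. real (range_count G S f (N ?k) y) \<le> \<rho> ?k} \<in> sets \<nu>"
      \<comment> \<open>Non-measurable sets have \<open>measure\<close> zero, so the positive lower bound forces measurability.\<close>
      proof (rule ccontr)
        assume "\<not> ?thesis"
        then show False using few[OF k(1)] \<epsilon> by (simp add: measure_notin_sets)
      qed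
      moreover have "f \<in> space \<nu> \<rightarrow> carrier G" using measurable_space[OF f] by auto
      ultimately have "prob {y \<in> space \<nu>. real (range_count G S f (N ?k) y) \<le> \<rho> ?k} / 2 - (1 - prob B)
          \<le> prob {y \<in> space \<nu>. real (N ?k) / \<rho> ?k / 4
                \<le> real (card (return_times G S f B y \<inter> {1..N ?k}))}"
        using N_pos[OF k(1)] \<rho>_pos[OF k(1)] by (intro measure_frequent_returns prob S G(1) B J)
      then show ?thesis
        using few[OF k(1)] l unfolding a_def n_def B_def[symmetric] by argo
    qed
    have not_fin: "\<not> (AE y in \<nu>. (\<Sum>i. indicator (return_times G S f B y) i * ennreal (\<omega> (real i))) \<noteq> \<infinity>)"
      by (rule not_AE_finite_of_frequent_times[OF prob J pos anti \<open>incseq n\<close> n_pos a_pos _ a_growth n_diverge _ frequent])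
        (use \<delta> \<epsilon> in simp_all)
    have A_inf: "weighted_visits T \<omega> A (y, \<one>\<^bsub>G\<^esub>) = \<infinity>"
      if "(\<Sum>i. indicator (return_times G S f B y) i * ennreal (\<omega> (real i))) = \<infinity>" for y
      unfolding weighted_visits_eq
    proof (rule weighted_times_delay[OF anti rv _ that])
      fix i assume i: "i \<in> return_times G S f B y"
      then obtain m where m: "m \<le> l" "(T ^^ m) ((S ^^ i) y, \<one>\<^bsub>G\<^esub>) \<in> A"
        unfolding return_times_def B_def by auto
      have "(T ^^ (i + m)) (y, \<one>\<^bsub>G\<^esub>) = (T ^^ m) ((T ^^ i) (y, \<one>\<^bsub>G\<^esub>))"
        by (simp add: funpow_add add.commute[of i])
      also have "(T ^^ i) (y, \<one>\<^bsub>G\<^esub>) = ((S ^^ i) y, \<one>\<^bsub>G\<^esub>)"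
        using i by (simp add: T_one return_times_def)
      finally show "\<exists>m\<le>l. i + m \<in> {i. (T ^^ i) (y, \<one>\<^bsub>G\<^esub>) \<in> A}" using m by auto
    qed
    have "\<not> (AE x in \<mu>. weighted_visits T \<omega> A x \<noteq> \<infinity>)"
    proof
      assume "AE x in \<mu>. weighted_visits T \<omega> A x \<noteq> \<infinity>"
      then have "AE y in \<nu>. weighted_visits T \<omega> A (y, \<one>\<^bsub>G\<^esub>) \<noteq> \<infinity>"
        unfolding \<mu>_def
        by (rule AE_section_of_AE_pair_count_space[OF sigma_finite_measure_axioms G(2) one_closed])
      then have "AE y in \<nu>. (\<Sum>i. indicator (return_times G S f B y) i * ennreal (\<omega> (real i))) \<noteq> \<infinity>"
        by eventually_elim (metis A_inf)
      then show False using not_fin by contradiction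
    qed
    then show "AE x in \<mu>. weighted_visits T \<omega> A x = \<infinity>"
      by (rule AE_weighted_visits_infinite[OF T erg A anti rv])
  qed
qed

end
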